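(* Let $\gamma(x,t)\in\mathbb{R}^2$ be a motion of an arc-length parametrized curve with angle function $\theta(x,t)$ (so that $\theta$ satisfies $\theta_t+\frac12(\theta_x)^3+\theta_{xxx}=0$). Let $\lambda$ be a non-zero real constant and let $\overline\theta(x,t)$ be a real function satisfying $$\frac{\partial}{\partial x}\left(\frac{\overline\theta-\theta}{2}\right)=2\lambda\sin\frac{\overline\theta+\theta}{2},$$ $$\frac{\partial}{\partial t}\left(\frac{\overline\theta-\theta}{2}\right)=-\lambda\left\{(\theta_x)^2+8\lambda^2\right\}\sin\frac{\overline\theta+\theta}{2}-2\lambda\theta_{xx}\cos\frac{\overline\theta+\theta}{2}-4\lambda^2\theta_x .$$ Then $$\overline\gamma(x,t)=S\left[\gamma(x,t)+\frac1\lambda\,R\left(-\frac{\overline\theta(x,t)+\theta(x,t)}{2}\right)\gamma'(x,t)\right],\qquad S=\begin{bmatrix}1&0\\0&-1\end{bmatrix},$$ is a motion of an arc-length parametrized curve with angle function $\overline\theta(x,t)$.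
   Context: $'$ denotes $\partial/\partial x$; $R(\phi)=\begin{pmatrix}\cos\phi&-\sin\phi\\ \sin\phi&\cos\phi\end{pmatrix}$; all functions are smooth. The bars are names of new real objects, not complex conjugates. A smooth $\gamma(x,t)\in\mathbb{R}^2$ is called a motion of an arc-length parametrized curve with angle function $\theta(x,t)$ if $\gamma'={}^t(\cos\theta,\sin\theta)$ (so $|\gamma'|=1$) and, with $\kappa=\theta_x$, $$\gamma''=\begin{bmatrix}0&-\kappa\\ \kappa&0\end{bmatrix}\gamma',\qquad \frac{\partial}{\partial t}\gamma'=\begin{bmatrix}0&\kappa''+\frac{\kappa^3}{2}\\ -\kappa''-\frac{\kappa^3}{2}&0\end{bmatrix}\gamma'.$$ *)

theory Defs
  imports "HOL-Analysis.Analysis"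
begin

(* Only meant for open S: the derivative is the two-sided Frechet derivative at each
   point, and every directional derivative has to be n times differentiable again. *)
primrec times_differentiable_on ::
  "nat \<Rightarrow> ('a::real_normed_vector \<Rightarrow> 'b::real_normed_vector) \<Rightarrow> 'a set \<Rightarrow> bool" where
  "times_differentiable_on 0 f S \<longleftrightarrow> continuous_on S f"
| "times_differentiable_on (Suc n) f S \<longleftrightarrow>
     (\<forall>p\<in>S. f differentiable (at p)) \<and>
     (\<forall>v. times_differentiable_on n (\<lambda>p. frechet_derivative f (at p) v) S)"

definition smooth_on ::
  "('a::real_normed_vector \<Rightarrow> 'b::real_normed_vector) \<Rightarrow> 'a set \<Rightarrow> bool" where
  "smooth_on f S \<longleftrightarrow> (\<forall>n. times_differentiable_on n f S)"

(* Functions of (x, t) are curried; joint smoothness is that of case_prod f on a subset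
   of the plane. The partial derivatives take a curried function to a curried function. *)
definition dx :: "(real \<Rightarrow> real \<Rightarrow> 'a::real_normed_vector) \<Rightarrow> real \<Rightarrow> real \<Rightarrow> 'a" where
  "dx f x t = vector_derivative (\<lambda>y. f y t) (at x)"

definition dt :: "(real \<Rightarrow> real \<Rightarrow> 'a::real_normed_vector) \<Rightarrow> real \<Rightarrow> real \<Rightarrow> 'a" where
  "dt f x t = vector_derivative (\<lambda>s. f x s) (at t)"

(* Matrices are lists of rows. *)
definition rotation :: "real \<Rightarrow> real^2^2" where
  "rotation \<phi> = vector [vector [cos \<phi>, - sin \<phi>], vector [sin \<phi>, cos \<phi>]]"

definition reflection :: "real^2^2" where
  "reflection = vector [vector [1, 0], vector [0, -1]]"

(* U is the open domain of the variables (x, t); outside U nothing is required. *)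
definition is_motion ::
  "(real \<times> real) set \<Rightarrow> (real \<Rightarrow> real \<Rightarrow> real^2) \<Rightarrow> (real \<Rightarrow> real \<Rightarrow> real) \<Rightarrow> bool" where
  "is_motion U \<gamma> \<theta> \<longleftrightarrow>
     smooth_on (case_prod \<gamma>) U \<and> smooth_on (case_prod \<theta>) U \<and>
     (\<forall>(x, t)\<in>U.
        dx \<gamma> x t = vector [cos (\<theta> x t), sin (\<theta> x t)] \<and>
        (let \<kappa> = dx \<theta>; a = dx (dx \<kappa>) x t + (\<kappa> x t) ^ 3 / 2 in
           dx (dx \<gamma>) x t =
             (vector [vector [0, - \<kappa> x t], vector [\<kappa> x t, 0]] :: real^2^2) *v dx \<gamma> x t \<and>
           dt (dx \<gamma>) x t =
             (vector [vector [0, a], vector [- a, 0]] :: real^2^2) *v dx \<gamma> x t))"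

end

(* Put \<phi> = (\<theta>bar - \<theta>) / 2 and \<psi> = (\<theta>bar + \<theta>) / 2. As \<gamma>' = (cos \<theta>, sin \<theta>), the transformed curve is
   the reflected \<gamma> plus (cos \<phi>, sin \<phi>) / lam. Its x-derivative is (cos \<theta>bar, sin \<theta>bar) by the x-equation
   and product-to-sum formulas, and then the frame equations for \<theta>bar say no more than
   \<theta>bar_t + \<theta>bar_xxx + \<theta>bar_x^3 / 2 = 0. This follows from the same equation for \<theta> by eliminating all
   x-derivatives of \<theta>bar with \<theta>bar_x = \<theta>_x + 4 lam sin \<psi>, \<psi>_x = \<theta>_x + 2 lam sin \<psi>. *)

theory Submission
  imports Defs
begin

subsection \<open>Calculus of smooth functions on open sets\<close>

text \<open>Openness makes the two functions agree near each point of \<open>S\<close>, so their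
  Frechet derivatives there coincide. The induction varies both functions because it passes to
  directional derivatives.\<close>

lemma times_differentiable_on_cong:
  assumes "open S" "\<And>p. p \<in> S \<Longrightarrow> f p = g p" "times_differentiable_on n f S"
  shows "times_differentiable_on n g S"
  using assms(2,3)
proof (induction n arbitrary: f g)
  case 0
  then show ?case using continuous_on_cong[of S S f g] by simp
next
  case (Suc n)
  have d: "(g has_derivative frechet_derivative f (at p)) (at p)" if "p \<in> S" for p
  proof (rule has_derivative_transform_within_open[OF _ \<open>open S\<close> that])
    show "(f has_derivative frechet_derivative f (at p)) (at p)"
      using Suc.prems(2) that by (simp add: frechet_derivative_works)
  qed (rule Suc.prems(1))
  then have "g differentiable (at p)" if "p \<in> S" for p
    using that by (auto simp: differentiable_def)
  moreover have "times_differentiable_on n (\<lambda>p. frechet_derivative g (at p) v) S" for v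
  proof (rule Suc.IH)
    show "frechet_derivative f (at p) v = frechet_derivative g (at p) v" if "p \<in> S" for p
      using frechet_derivative_at[OF d[OF that]] by simp
    show "times_differentiable_on n (\<lambda>p. frechet_derivative f (at p) v) S"
      using Suc.prems(2) by simp
  qed
  ultimately show ?case by simp
qed

text \<open>By uniqueness of the derivative, an explicit \<open>f'\<close> may replace the chosen
  \<open>frechet_derivative\<close>. The closure properties below are inductions through this rule,
  each fed with a differentiation rule.\<close>

lemma times_differentiable_on_SucI:
  assumes "open S" "\<And>p. p \<in> S \<Longrightarrow> (f has_derivative f' p) (at p)"
    and "\<And>v. times_differentiable_on n (\<lambda>p. f' p v) S"
  shows "times_differentiable_on (Suc n) f S"
proof -
  have "times_differentiable_on n (\<lambda>p. frechet_derivative f (at p) v) S" for v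
  proof (rule times_differentiable_on_cong[OF assms(1) _ assms(3)])
    show "f' p v = frechet_derivative f (at p) v" if "p \<in> S" for p
      using frechet_derivative_at[OF assms(2)[OF that]] by simp
  qed
  then show ?thesis using assms(2) by (auto simp: differentiable_def)
qed

text \<open>Differentiability implies continuity at the base, and the step descends to directional
  derivatives. The product rule needs this, since undifferentiated factors survive in it and must be
  lowered to order \<open>n\<close>.\<close>

lemma times_differentiable_on_SucD:
  "times_differentiable_on (Suc n) f S \<Longrightarrow> times_differentiable_on n f S"
proof (induction n arbitrary: f)
  case 0
  then show ?case
    by (auto intro!: continuous_at_imp_continuous_on differentiable_imp_continuous_within)
next
  case (Suc n)
  then show ?case by (metis times_differentiable_on.simps(2))
qed

lemma times_differentiable_on_has_derivative:
  "times_differentiable_on (Suc n) f S \<Longrightarrow> p \<in> S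
    \<Longrightarrow> (f has_derivative frechet_derivative f (at p)) (at p)"
  by (simp add: frechet_derivative_works)

lemma times_differentiable_on_const:
  assumes "open S" shows "times_differentiable_on n (\<lambda>p. c) S"
proof (induction n arbitrary: c)
  case (Suc n)
  show ?case
    using Suc assms by (intro times_differentiable_on_SucI[where f' = "\<lambda>p v. 0"]) auto
qed simp

lemma times_differentiable_on_add:
  assumes "open S" "times_differentiable_on n f S" "times_differentiable_on n g S"
  shows "times_differentiable_on n (\<lambda>p. f p + g p) S"
  using assms(2,3)
proof (induction n arbitrary: f g)
  case (Suc n)
  show ?case
  proof (rule times_differentiable_on_SucI[OF \<open>open S\<close>])
    show "((\<lambda>p. f p + g p) has_derivative
        (\<lambda>v. frechet_derivative f (at p) v + frechet_derivative g (at p) v)) (at p)" if "p \<in> S" for p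
      using that by (intro has_derivative_add times_differentiable_on_has_derivative[OF Suc.prems(1)]
          times_differentiable_on_has_derivative[OF Suc.prems(2)])
    show "times_differentiable_on n
        (\<lambda>p. frechet_derivative f (at p) v + frechet_derivative g (at p) v) S" for v
      using Suc.prems by (intro Suc.IH) simp_all
  qed
qed (auto intro: continuous_intros)

text \<open>One induction serves both multiplication of reals and \<open>scaleR\<close>.\<close>

lemma times_differentiable_on_bounded_bilinear:
  assumes "bounded_bilinear h" "open S" "times_differentiable_on n f S" "times_differentiable_on n g S"
  shows "times_differentiable_on n (\<lambda>p. h (f p) (g p)) S"
  using assms(3,4)
proof (induction n arbitrary: f g)
  case 0
  then show ?case by (auto intro: bounded_bilinear.continuous_on[OF assms(1)])
next
  case (Suc n)
  show ?case
  proof (rule times_differentiable_on_SucI[OF \<open>open S\<close>])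
    show "((\<lambda>p. h (f p) (g p)) has_derivative
        (\<lambda>v. h (f p) (frechet_derivative g (at p) v) + h (frechet_derivative f (at p) v) (g p))) (at p)"
      if "p \<in> S" for p
      using that by (intro bounded_bilinear.FDERIV[OF assms(1)]
          times_differentiable_on_has_derivative[OF Suc.prems(1)]
          times_differentiable_on_has_derivative[OF Suc.prems(2)])
    show "times_differentiable_on n (\<lambda>p. h (f p) (frechet_derivative g (at p) v)
        + h (frechet_derivative f (at p) v) (g p)) S" for v
      using Suc.prems times_differentiable_on_SucD[OF Suc.prems(1)] times_differentiable_on_SucD[OF Suc.prems(2)]
      by (intro times_differentiable_on_add[OF \<open>open S\<close>] Suc.IH) simp_all
  qed
qed

lemma times_differentiable_on_bounded_linear:
  assumes "bounded_linear h" "open S" "times_differentiable_on n f S"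
  shows "times_differentiable_on n (\<lambda>p. h (f p)) S"
  using assms(3)
proof (induction n arbitrary: f)
  case 0
  then show ?case by (auto intro: bounded_linear.continuous_on[OF assms(1)])
next
  case (Suc n)
  show ?case
  proof (rule times_differentiable_on_SucI[OF \<open>open S\<close>])
    show "((\<lambda>p. h (f p)) has_derivative (\<lambda>v. h (frechet_derivative f (at p) v))) (at p)"
      if "p \<in> S" for p
      by (intro bounded_linear.has_derivative[OF assms(1)]
          times_differentiable_on_has_derivative[OF Suc.prems that])
    show "times_differentiable_on n (\<lambda>p. h (frechet_derivative f (at p) v)) S" for v
      using Suc.prems by (intro Suc.IH) simp
  qed
qed

text \<open>The two claims are proved together because the derivative of each function contains the
  other. This replaces a general theorem on compositions.\<close>

lemma times_differentiable_on_sin_cos: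
  fixes f :: "'a::real_normed_vector \<Rightarrow> real"
  assumes "open S" "times_differentiable_on n f S"
  shows "times_differentiable_on n (\<lambda>p. sin (f p)) S \<and> times_differentiable_on n (\<lambda>p. cos (f p)) S"
  using assms(2)
proof (induction n)
  case 0
  then show ?case by (auto intro: continuous_intros)
next
  case (Suc n)
  note IH = Suc.IH[OF times_differentiable_on_SucD[OF Suc.prems]]
  let ?D = "\<lambda>p. frechet_derivative f (at p)"
  have D: "times_differentiable_on n (\<lambda>p. ?D p v) S" for v
    using Suc.prems by simp
  note mult = times_differentiable_on_bounded_bilinear[OF bounded_bilinear_mult \<open>open S\<close>]
  have "times_differentiable_on (Suc n) (\<lambda>p. sin (f p)) S"
  proof (rule times_differentiable_on_SucI[OF \<open>open S\<close>])
    show "((\<lambda>p. sin (f p)) has_derivative (\<lambda>v. ?D p v * cos (f p))) (at p)" if "p \<in> S" for p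
      by (rule has_derivative_sin[OF times_differentiable_on_has_derivative[OF Suc.prems that], simplified])
  qed (intro mult D IH[THEN conjunct2])
  moreover have "times_differentiable_on (Suc n) (\<lambda>p. cos (f p)) S"
  proof (rule times_differentiable_on_SucI[OF \<open>open S\<close>])
    \<comment> \<open>The sign is written as a constant factor, so that closure under products and
      constants suffices.\<close>
    show "((\<lambda>p. cos (f p)) has_derivative (\<lambda>v. ?D p v * (- 1 * sin (f p)))) (at p)" if "p \<in> S" for p
      using has_derivative_cos[OF times_differentiable_on_has_derivative[OF Suc.prems that]] by simp
  qed (intro mult D IH[THEN conjunct1] times_differentiable_on_const \<open>open S\<close>)
  ultimately show ?case by blast
qed

section \<open>Transfer to smoothness of all orders\<close>

lemma smooth_on_cong:
  "open S \<Longrightarrow> (\<And>p. p \<in> S \<Longrightarrow> f p = g p) \<Longrightarrow> smooth_on f S \<Longrightarrow> smooth_on g S"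
  unfolding smooth_on_def using times_differentiable_on_cong by blast

lemma smooth_on_const: "open S \<Longrightarrow> smooth_on (\<lambda>p. c) S"
  by (simp add: smooth_on_def times_differentiable_on_const)

lemma smooth_on_add:
  "open S \<Longrightarrow> smooth_on f S \<Longrightarrow> smooth_on g S \<Longrightarrow> smooth_on (\<lambda>p. f p + g p) S"
  by (simp add: smooth_on_def times_differentiable_on_add)

lemma smooth_on_bounded_linear:
  "bounded_linear h \<Longrightarrow> open S \<Longrightarrow> smooth_on f S \<Longrightarrow> smooth_on (\<lambda>p. h (f p)) S"
  by (simp add: smooth_on_def times_differentiable_on_bounded_linear)

lemma smooth_on_scaleR:
  "open S \<Longrightarrow> smooth_on f S \<Longrightarrow> smooth_on g S \<Longrightarrow> smooth_on (\<lambda>p. f p *\<^sub>R g p) S"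
  by (simp add: smooth_on_def times_differentiable_on_bounded_bilinear[OF bounded_bilinear_scaleR])

lemma smooth_on_sin: "open S \<Longrightarrow> smooth_on f S \<Longrightarrow> smooth_on (\<lambda>p. sin (f p :: real)) S"
  by (simp add: smooth_on_def times_differentiable_on_sin_cos)

lemma smooth_on_cos: "open S \<Longrightarrow> smooth_on f S \<Longrightarrow> smooth_on (\<lambda>p. cos (f p :: real)) S"
  by (simp add: smooth_on_def times_differentiable_on_sin_cos)

lemma smooth_on_has_derivative:
  "smooth_on f S \<Longrightarrow> p \<in> S \<Longrightarrow> (f has_derivative frechet_derivative f (at p)) (at p)"
  unfolding smooth_on_def using times_differentiable_on_has_derivative by blast

lemma smooth_on_frechet_derivative:
  "smooth_on f S \<Longrightarrow> smooth_on (\<lambda>p. frechet_derivative f (at p) v) S"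
  unfolding smooth_on_def by (metis times_differentiable_on.simps(2))

subsection \<open>Partial derivatives\<close>

lemma dx_eqI: "((\<lambda>y. f y t) has_vector_derivative d) (at x) \<Longrightarrow> dx f x t = d"
  by (simp add: dx_def vector_derivative_at)

lemma dt_eqI: "((\<lambda>s. f x s) has_vector_derivative d) (at t) \<Longrightarrow> dt f x t = d"
  by (simp add: dt_def vector_derivative_at)

text \<open>The chain rule along the affine map \<open>y\<close> to \<open>(y, t)\<close> identifies
  the partial derivative with the directional derivative along \<open>(1, 0)\<close>, which is the
  object that \<open>smooth_on\<close> controls.\<close>

lemma has_vector_derivative_slice_x:
  assumes "smooth_on (case_prod f) U" "(x, t) \<in> U"
  shows "((\<lambda>y. f y t) has_vector_derivative frechet_derivative (case_prod f) (at (x, t)) (1, 0)) (at x)"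
proof -
  let ?D = "frechet_derivative (case_prod f) (at (x, t))"
  have D: "(case_prod f has_derivative ?D) (at (x, t))"
    using smooth_on_has_derivative[OF assms] .
  have "((\<lambda>y. (y, t)) has_derivative (\<lambda>h. (h, 0))) (at x)"
    by (rule has_derivative_Pair[OF has_derivative_ident has_derivative_const])
  from has_derivative_compose[OF this D]
  have "((\<lambda>y. f y t) has_derivative (\<lambda>h. ?D (h, 0))) (at x)" by simp
  moreover have "(\<lambda>h. ?D (h, 0)) = (\<lambda>h. h *\<^sub>R ?D (1, 0))"
    proof
    show "?D (h, 0) = h *\<^sub>R ?D (1, 0)" for h
      using linear_cmul[OF has_derivative_linear[OF D], of h "(1, 0)"] by simp
  qed
  ultimately show ?thesis by (simp only: has_vector_derivative_def)
qed

lemma has_vector_derivative_slice_t: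
  assumes "smooth_on (case_prod f) U" "(x, t) \<in> U"
  shows "((\<lambda>s. f x s) has_vector_derivative frechet_derivative (case_prod f) (at (x, t)) (0, 1)) (at t)"
proof -
  let ?D = "frechet_derivative (case_prod f) (at (x, t))"
  have D: "(case_prod f has_derivative ?D) (at (x, t))"
    using smooth_on_has_derivative[OF assms] .
  have "((\<lambda>s. (x, s)) has_derivative (\<lambda>h. (0, h))) (at t)"
    by (rule has_derivative_Pair[OF has_derivative_const has_derivative_ident])
  from has_derivative_compose[OF this D]
  have "((\<lambda>s. f x s) has_derivative (\<lambda>h. ?D (0, h))) (at t)" by simp
  moreover have "(\<lambda>h. ?D (0, h)) = (\<lambda>h. h *\<^sub>R ?D (0, 1))"
    proof
    show "?D (0, h) = h *\<^sub>R ?D (0, 1)" for h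
      using linear_cmul[OF has_derivative_linear[OF D], of h "(0, 1)"] by simp
  qed
  ultimately show ?thesis by (simp only: has_vector_derivative_def)
qed

lemma has_vector_derivative_dx:
  "smooth_on (case_prod f) U \<Longrightarrow> (x, t) \<in> U \<Longrightarrow> ((\<lambda>y. f y t) has_vector_derivative dx f x t) (at x)"
  by (frule (1) has_vector_derivative_slice_x) (metis dx_eqI)

lemma has_vector_derivative_dt:
  "smooth_on (case_prod f) U \<Longrightarrow> (x, t) \<in> U \<Longrightarrow> ((\<lambda>s. f x s) has_vector_derivative dt f x t) (at t)"
  by (frule (1) has_vector_derivative_slice_t) (metis dt_eqI)

text \<open>On \<open>U\<close> the partial derivative is a directional derivative of
  \<open>case_prod f\<close>, and smoothness passes to those by definition.\<close>

lemma smooth_on_dx: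
  assumes "open U" "smooth_on (case_prod f) U"
  shows "smooth_on (case_prod (dx f)) U"
proof (rule smooth_on_cong[OF \<open>open U\<close> _ smooth_on_frechet_derivative[OF assms(2), of "(1, 0)"]])
  fix p assume "p \<in> U"
  then show "frechet_derivative (case_prod f) (at p) (1, 0) = case_prod (dx f) p"
    by (cases p) (simp add: dx_eqI[OF has_vector_derivative_slice_x[OF assms(2)]])
qed

text \<open>Identities known only on \<open>U\<close> may still be differentiated: the slice of
  \<open>U\<close> through the point is open in the line, so the identity holds in a neighbourhood
  of \<open>x\<close>.\<close>

lemma dx_eqI_open:
  assumes "open U" "(x, t) \<in> U" "\<And>y s. (y, s) \<in> U \<Longrightarrow> f y s = g y s"
    and "((\<lambda>y. g y t) has_vector_derivative d) (at x)"
  shows "dx f x t = d"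
proof (rule dx_eqI, rule has_vector_derivative_transform_within_open[OF assms(4)])
  have "open ((\<lambda>y. (y, t)) -` U)"
    using \<open>open U\<close> by (intro open_vimage continuous_intros)
  then show "open {y. (y, t) \<in> U}" by (simp add: vimage_def)
qed (simp_all add: assms(2,3))

lemma dt_eqI_open:
  assumes "open U" "(x, t) \<in> U" "\<And>y s. (y, s) \<in> U \<Longrightarrow> f y s = g y s"
    and "((\<lambda>s. g x s) has_vector_derivative d) (at t)"
  shows "dt f x t = d"
proof (rule dt_eqI, rule has_vector_derivative_transform_within_open[OF assms(4)])
  have "open (Pair x -` U)"
    using \<open>open U\<close> by (intro open_vimage continuous_intros)
  then show "open {s. (x, s) \<in> U}" by (simp add: vimage_def)
qed (simp_all add: assms(2,3))

lemma has_real_derivative_dx: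
  "smooth_on (case_prod f) U \<Longrightarrow> (x, t) \<in> U \<Longrightarrow> ((\<lambda>y. f y t) has_real_derivative dx f x t) (at x)"
  unfolding has_real_derivative_iff_has_vector_derivative by (rule has_vector_derivative_dx)

lemma has_real_derivative_dt:
  "smooth_on (case_prod f) U \<Longrightarrow> (x, t) \<in> U \<Longrightarrow> ((\<lambda>s. f x s) has_real_derivative dt f x t) (at t)"
  unfolding has_real_derivative_iff_has_vector_derivative by (rule has_vector_derivative_dt)

subsection \<open>Plane curves\<close>

text \<open>With fixed basis vectors, differentiability and smoothness of a plane vector reduce to
  those of its scalar coefficients.\<close>

lemma vector_2_eq_axis: "(vector [a, b] :: real^2) = a *\<^sub>R axis 1 1 + b *\<^sub>R axis 2 1"
  by (simp add: vec_eq_iff forall_2 axis_def)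

lemma vec2_eq_iff: "(v :: real^2) = w \<longleftrightarrow> v $ 1 = w $ 1 \<and> v $ 2 = w $ 2"
  by (simp add: vec_eq_iff forall_2)

lemma has_vector_derivative_vector_2:
  assumes "(a has_real_derivative a') F" "(b has_real_derivative b') F"
  shows "((\<lambda>y. vector [a y, b y] :: real^2) has_vector_derivative vector [a', b']) F"
  unfolding vector_2_eq_axis
  using assms[unfolded has_real_derivative_iff_has_vector_derivative]
  by (intro has_vector_derivative_add bounded_linear.has_vector_derivative[OF bounded_linear_scaleR_left])

lemma has_vector_derivative_unit_circle:
  assumes "(f has_real_derivative f') (at x)"
  shows "((\<lambda>y. vector [cos (f y), sin (f y)] :: real^2) has_vector_derivative
    vector [- sin (f x) * f', cos (f x) * f']) (at x)"
  by (intro has_vector_derivative_vector_2) (auto intro!: derivative_eq_intros assms)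

text \<open>The two frame equations reduce to the scalar equation: both sides of the \<open>t\<close>-equation
  are multiples of the unit normal.\<close>

lemma is_motion_iff:
  assumes "open U"
  shows "is_motion U \<gamma> \<theta> \<longleftrightarrow>
    smooth_on (case_prod \<gamma>) U \<and> smooth_on (case_prod \<theta>) U \<and>
    (\<forall>(x, t)\<in>U. dx \<gamma> x t = vector [cos (\<theta> x t), sin (\<theta> x t)] \<and>
      dt \<theta> x t = - (dx (dx (dx \<theta>)) x t + dx \<theta> x t ^ 3 / 2))"
proof -
  let ?T = "\<lambda>x t. vector [cos (\<theta> x t), sin (\<theta> x t)] :: real^2"
  \<comment> \<open>The first frame equation is automatic, being the \<open>x\<close>-derivative of
    the unit tangent; only the second carries information. The number \<open>a\<close> stays
    arbitrary until the definition of a motion is unfolded.\<close>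
  have "(dx (dx \<gamma>) x t = (vector [vector [0, - dx \<theta> x t], vector [dx \<theta> x t, 0]] :: real^2^2) *v dx \<gamma> x t \<and>
         dt (dx \<gamma>) x t = (vector [vector [0, a], vector [- a, 0]] :: real^2^2) *v dx \<gamma> x t)
       \<longleftrightarrow> dt \<theta> x t = - a"
    if "smooth_on (case_prod \<theta>) U" and T: "\<And>x t. (x, t) \<in> U \<Longrightarrow> dx \<gamma> x t = ?T x t" and xt: "(x, t) \<in> U"
    for x t a
  proof -
    have "dx (dx \<gamma>) x t = vector [- sin (\<theta> x t) * dx \<theta> x t, cos (\<theta> x t) * dx \<theta> x t]"
      using that by (intro dx_eqI_open[OF assms xt T] has_vector_derivative_unit_circle has_real_derivative_dx)
    moreover have "dt (dx \<gamma>) x t = vector [- sin (\<theta> x t) * dt \<theta> x t, cos (\<theta> x t) * dt \<theta> x t]"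
      using that by (intro dt_eqI_open[OF assms xt T] has_vector_derivative_unit_circle has_real_derivative_dt)
    moreover have "- sin (\<theta> x t) * dt \<theta> x t = a * sin (\<theta> x t) \<and> cos (\<theta> x t) * dt \<theta> x t = - a * cos (\<theta> x t)
        \<longleftrightarrow> dt \<theta> x t = - a"
    proof
      assume "- sin (\<theta> x t) * dt \<theta> x t = a * sin (\<theta> x t) \<and> cos (\<theta> x t) * dt \<theta> x t = - a * cos (\<theta> x t)"
      then have "sin (\<theta> x t) * (dt \<theta> x t + a) = 0" "cos (\<theta> x t) * (dt \<theta> x t + a) = 0"
        by (auto simp: algebra_simps)
      \<comment> \<open>Sine and cosine have no common zero, so the trigonometric factor cancels in
        at least one of the two equations.\<close>
      moreover have "sin (\<theta> x t) \<noteq> 0 \<or> cos (\<theta> x t) \<noteq> 0"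
        using sin_cos_squared_add[of "\<theta> x t"] by force
      ultimately show "dt \<theta> x t = - a" by auto
    qed auto
    ultimately show ?thesis
      by (simp add: T[OF xt] vec2_eq_iff matrix_vector_mult_def sum_2 mult.commute)
  qed
  note frame = this
  show ?thesis
    unfolding is_motion_def Let_def using frame by fast
qed

section \<open>The transformed curve: its tangent and the evolution of its angle\<close>

theorem proposition4p7:
  fixes U :: "(real \<times> real) set"
    and \<gamma> :: "real \<Rightarrow> real \<Rightarrow> real^2"
    and \<theta> \<theta>bar :: "real \<Rightarrow> real \<Rightarrow> real"
    and lam :: real
  assumes "open U"
    and "is_motion U \<gamma> \<theta>"
    and "lam \<noteq> 0"
    and "smooth_on (case_prod \<theta>bar) U"
    and "\<And>x t. (x, t) \<in> U \<Longrightarrow>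
           dx (\<lambda>x t. (\<theta>bar x t - \<theta> x t) / 2) x t = 2 * lam * sin ((\<theta>bar x t + \<theta> x t) / 2)"
    and "\<And>x t. (x, t) \<in> U \<Longrightarrow>
           dt (\<lambda>x t. (\<theta>bar x t - \<theta> x t) / 2) x t =
             - lam * ((dx \<theta> x t)^2 + 8 * lam^2) * sin ((\<theta>bar x t + \<theta> x t) / 2)
             - 2 * lam * dx (dx \<theta>) x t * cos ((\<theta>bar x t + \<theta> x t) / 2)
             - 4 * lam^2 * dx \<theta> x t"
  shows "is_motion U
           (\<lambda>x t. reflection *v
              (\<gamma> x t + (1 / lam) *\<^sub>R (rotation (- ((\<theta>bar x t + \<theta> x t) / 2)) *v dx \<gamma> x t)))
           \<theta>bar"
proof -
  define \<phi> \<psi> where "\<phi> = (\<lambda>x t. (\<theta>bar x t - \<theta> x t) / 2)" and "\<psi> = (\<lambda>x t. (\<theta>bar x t + \<theta> x t) / 2)"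
  define \<gamma>bar where "\<gamma>bar = (\<lambda>x t. reflection *v
    (\<gamma> x t + (1 / lam) *\<^sub>R (rotation (- ((\<theta>bar x t + \<theta> x t) / 2)) *v dx \<gamma> x t)))"
  define \<kappa> where "\<kappa> = dx \<theta>"
  note U = \<open>open U\<close> and bar = assms(4)
  from assms(2) have \<gamma>: "smooth_on (case_prod \<gamma>) U" and \<theta>: "smooth_on (case_prod \<theta>) U"
    and \<gamma>': "\<And>x t. (x, t) \<in> U \<Longrightarrow> dx \<gamma> x t = vector [cos (\<theta> x t), sin (\<theta> x t)]"
    and \<theta>t: "\<And>x t. (x, t) \<in> U \<Longrightarrow> dt \<theta> x t = - (dx (dx \<kappa>) x t + \<kappa> x t ^ 3 / 2)"
    by (auto simp: is_motion_iff[OF U] \<kappa>_def)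
  note dbar = has_real_derivative_dx[OF bar] and d\<theta> = has_real_derivative_dx[OF \<theta>]
  have \<kappa>: "smooth_on (case_prod \<kappa>) U" and \<kappa>': "smooth_on (case_prod (dx \<kappa>)) U"
    unfolding \<kappa>_def using \<theta> U by (auto intro: smooth_on_dx)

  have \<phi>: "smooth_on (case_prod \<phi>) U"
  proof -
    have "smooth_on (\<lambda>p. (1/2) *\<^sub>R (case_prod \<theta>bar p + (-1) *\<^sub>R case_prod \<theta> p)) U"
      using bar \<theta> U by (intro smooth_on_scaleR smooth_on_add smooth_on_const)
    then show ?thesis by (rule smooth_on_cong[OF U, rotated]) (auto simp: \<phi>_def)
  qed
  \<comment> \<open>Two expressions for the \<open>x\<close>-derivative of \<phi> are kept, one from
    the hypothesis and one from linearity. Comparing them later yields the derivative of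
    \<open>\<theta>bar\<close>.\<close>
  have \<phi>x: "dx \<phi> x t = 2 * lam * sin (\<psi> x t)" if "(x, t) \<in> U" for x t
    using assms(5)[OF that] by (simp add: \<phi>_def \<psi>_def)
  have \<phi>x': "dx \<phi> x t = (dx \<theta>bar x t - dx \<theta> x t) / 2" if "(x, t) \<in> U" for x t
    unfolding \<phi>_def
    by (rule dx_eqI, rule has_real_derivative_iff_has_vector_derivative[THEN iffD1])
      (auto intro!: derivative_eq_intros dbar d\<theta> that)
  have \<phi>t': "dt \<phi> x t = (dt \<theta>bar x t - dt \<theta> x t) / 2" if "(x, t) \<in> U" for x t
    unfolding \<phi>_def
    by (rule dt_eqI, rule has_real_derivative_iff_has_vector_derivative[THEN iffD1])
      (auto intro!: derivative_eq_intros has_real_derivative_dt[OF bar] has_real_derivative_dt[OF \<theta>] that)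

  \<comment> \<open>The tangent of \<gamma> has angle \<theta>. Rotation by -\<psi> turns it into
    \<theta> - \<psi> = -\<phi>, and the reflection changes this to \<phi>.\<close>
  have \<gamma>bar: "\<gamma>bar x t = reflection *v \<gamma> x t + (1 / lam) *\<^sub>R vector [cos (\<phi> x t), sin (\<phi> x t)]"
    if "(x, t) \<in> U" for x t
  proof -
    have \<phi>_eq: "\<phi> x t = \<psi> x t - \<theta> x t" and \<psi>_eq: "(\<theta>bar x t + \<theta> x t) / 2 = \<psi> x t"
      by (simp_all add: \<phi>_def \<psi>_def field_simps)
    show ?thesis
      unfolding \<gamma>bar_def \<gamma>'[OF that] \<phi>_eq \<psi>_eq
      by (simp add: vec2_eq_iff reflection_def rotation_def matrix_vector_mult_def sum_2
          cos_diff sin_diff algebra_simps)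
  qed
  have "smooth_on (case_prod \<gamma>bar) U"
  proof (rule smooth_on_cong[OF U])
    show "smooth_on (\<lambda>p. reflection *v case_prod \<gamma> p +
        (1 / lam) *\<^sub>R (cos (case_prod \<phi> p) *\<^sub>R axis 1 1 + sin (case_prod \<phi> p) *\<^sub>R axis 2 1)) U"
      by (intro smooth_on_add smooth_on_scaleR smooth_on_const smooth_on_cos smooth_on_sin
          smooth_on_bounded_linear[OF matrix_vector_mul_bounded_linear] U \<phi> \<gamma>)
  qed (auto simp: \<gamma>bar vector_2_eq_axis)
  moreover have "dx \<gamma>bar x t = vector [cos (\<theta>bar x t), sin (\<theta>bar x t)]" if xt: "(x, t) \<in> U" for x t
  proof -
    have "dx \<gamma>bar x t = reflection *v dx \<gamma> x t +
        (1 / lam) *\<^sub>R vector [- sin (\<phi> x t) * dx \<phi> x t, cos (\<phi> x t) * dx \<phi> x t]"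
      by (intro dx_eqI_open[OF U xt \<gamma>bar] has_vector_derivative_add
          bounded_linear.has_vector_derivative[OF matrix_vector_mul_bounded_linear]
          bounded_linear.has_vector_derivative[OF bounded_linear_scaleR_right]
          has_vector_derivative_unit_circle has_real_derivative_dx[OF \<phi> xt] has_vector_derivative_dx[OF \<gamma> xt])
    \<comment> \<open>The factor 1 / \<open>lam\<close> cancels against 2 \<open>lam\<close> sin
      \<psi>. In terms of \<psi> and \<phi> the components to check are cos(\<psi> - \<phi>) - 2 sin
      \<phi> sin \<psi> = cos(\<psi> + \<phi>) and -sin(\<psi> - \<phi>) + 2 cos \<phi> sin \<psi> =
      sin(\<psi> + \<phi>).\<close>
    moreover have "\<theta>bar x t = \<psi> x t + \<phi> x t" "\<theta> x t = \<psi> x t - \<phi> x t"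
      by (simp_all add: \<phi>_def \<psi>_def field_simps)
    ultimately show ?thesis
      using \<open>lam \<noteq> 0\<close>
      by (simp add: \<gamma>'[OF xt] \<phi>x[OF xt] vec2_eq_iff reflection_def matrix_vector_mult_def sum_2
          cos_add sin_add cos_diff sin_diff)
  qed
  moreover have "dt \<theta>bar x t = - (dx (dx (dx \<theta>bar)) x t + dx \<theta>bar x t ^ 3 / 2)" if xt: "(x, t) \<in> U" for x t
  proof -
    \<comment> \<open>\<open>bar1\<close> and \<open>bar2\<close> are stated on all of
      \<open>U\<close> because each is differentiated again; \<open>bar3\<close> is needed only at
      the given point.\<close>
    have bar1: "dx \<theta>bar x t = \<kappa> x t + 4 * lam * sin (\<psi> x t)" if "(x, t) \<in> U" for x t
      using \<phi>x[OF that] \<phi>x'[OF that] by (simp add: \<kappa>_def)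
    have \<psi>: "((\<lambda>y. \<psi> y t) has_real_derivative \<kappa> x t + 2 * lam * sin (\<psi> x t)) (at x)"
      if "(x, t) \<in> U" for x t
      using bar1[OF that] unfolding \<psi>_def
      by (auto intro!: derivative_eq_intros dbar d\<theta> that simp: \<kappa>_def)
    have bar2: "dx (dx \<theta>bar) x t =
        dx \<kappa> x t + 4 * lam * (cos (\<psi> x t) * (\<kappa> x t + 2 * lam * sin (\<psi> x t)))" if "(x, t) \<in> U" for x t
      by (rule dx_eqI_open[OF U that bar1], assumption,
          rule has_real_derivative_iff_has_vector_derivative[THEN iffD1])
        (auto intro!: derivative_eq_intros \<psi> has_real_derivative_dx[OF \<kappa>] that)
    have bar3: "dx (dx (dx \<theta>bar)) x t = dx (dx \<kappa>) x t + 4 * lam *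
        (- sin (\<psi> x t) * (\<kappa> x t + 2 * lam * sin (\<psi> x t))^2 +
          cos (\<psi> x t) * (dx \<kappa> x t + 2 * lam * (cos (\<psi> x t) * (\<kappa> x t + 2 * lam * sin (\<psi> x t)))))"
      by (rule dx_eqI_open[OF U xt bar2], assumption,
          rule has_real_derivative_iff_has_vector_derivative[THEN iffD1])
        (auto intro!: derivative_eq_intros \<psi> has_real_derivative_dx[OF \<kappa>] has_real_derivative_dx[OF \<kappa>'] xt
          simp: power2_eq_square)
    \<comment> \<open>This is \<open>\<theta>bar\<close> = \<theta> + 2 \<phi>, so the two known
      evolution equations determine the left-hand side.\<close>
    have "dt \<theta>bar x t = dt \<theta> x t + 2 * dt \<phi> x t"
      using \<phi>t'[OF xt] by simp
    also have "dt \<phi> x t = - lam * ((\<kappa> x t)^2 + 8 * lam^2) * sin (\<psi> x t)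
        - 2 * lam * dx \<kappa> x t * cos (\<psi> x t) - 4 * lam^2 * \<kappa> x t"
      using assms(6)[OF xt] by (simp add: \<phi>_def \<psi>_def \<kappa>_def)
    \<comment> \<open>What remains is a polynomial identity in \<kappa>, its first two
      \<open>x\<close>-derivatives, \<open>lam\<close>, sin \<psi> and cos \<psi>. Modulo sin^2 +
      cos^2 = 1 both sides agree; that relation enters in the terms of degree one and zero in
      \<kappa>.\<close>
    finally show ?thesis
      using sin_cos_squared_add[of "\<psi> x t"]
      unfolding bar3 bar1[OF xt] \<theta>t[OF xt] by algebra
  qed
  ultimately show ?thesis
    unfolding is_motion_iff[OF U] using bar by (auto simp: \<gamma>bar_def)
qed

end
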